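(* Let $A$ be an event and $\mathcal B$ a partition of $\Omega$ into non-empty events. Let $\underline P$ be an (unconditional) coherent lower probability on a set of events $\mathcal D$ containing $A$, $A^{\mathsf c}$ and every $B\in\mathcal B$, and let $\overline P$ be its conjugate. Suppose $A$ is an extreme event that is logically independent of $\mathcal B$. Let $\underline E(A|B),\overline E(A|B)$ be the natural extensions for $B\in\mathcal B$. Then for each $B\in\mathcal B$: (a) If $\underline P(B)>0$, the chain $\underline E(A|B)\le\underline P(A)\le\overline P(A)\le\overline E(A|B)$ holds trivially, i.e. with all three inequalities being equalities. (b) If $\underline P(B)=0$, the chain $\underline E(A|B)\le\underline P(A)\le\overline P(A)\le\overline E(A|B)$ holds, not trivially, one outer inequality being strict.
   Context: Events are subsets of a set $\Omega$ (the sure event); $B\Rightarrow A$ means $B\subseteq A$, and an unconditional event $A$ is identified with $A|\Omega$. A full conditional probability on an algebra of events is a map $P(\cdot|\cdot)$ such that for each non-empty $B$, $P(\cdot|B)$ is a finitely additive probability with $P(B|B)=1$, and $P(A\wedge C|B)=P(A|C\wedge B)\,P(C|B)$ whenever $C\wedge B\ne\emptyset$. A lower probability $\underline P$ on a set $\mathcal D$ of unconditional events is coherent if it is the pointwise infimum of a non-empty set of restrictions to $\mathcal D$ of finitely additive probabilities on an algebra containing $\mathcal D$; its conjugate is $\overline P(A)=1-\underline P(A^{\mathsf c})$. Natural extension: $\underline E(A|B)=\inf P(A|B)$ and $\overline E(A|B)=\sup P(A|B)$, over all full conditional probabilities $P$ on an algebra containing $\mathcal D$ (e.g. the power set of $\Omega$)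 with $P\ge\underline P$ on $\mathcal D$. $A$ is extreme if $\underline P(A)=\overline P(A)=0$ or $\underline P(A)=\overline P(A)=1$. $A$ is logically independent of $\mathcal B$ if $B\not\Rightarrow A$ and $B\not\Rightarrow A^{\mathsf c}$ for all $B\in\mathcal B$. *)

theory Defs
  imports "HOL-Analysis.Measure_Space"
begin

text \<open>
  Events are subsets of a set \<open>\<Omega>\<close>. All probabilities are real-valued and total as HOL
  functions; only their values on the relevant algebra matter, and for a conditional probability
  \<open>P E B\<close> (read: \<open>P(E|B)\<close>) only those with nonempty \<open>B\<close>. An unconditional event \<open>E\<close> is
  identified with \<open>E|\<Omega>\<close>.
\<close>

definition fa_probability :: "'a set \<Rightarrow> 'a set set \<Rightarrow> ('a set \<Rightarrow> real) \<Rightarrow> bool" where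
  "fa_probability \<Omega> \<F> p \<longleftrightarrow> (\<forall>E\<in>\<F>. 0 \<le> p E) \<and> p \<Omega> = 1 \<and> additive \<F> p"

definition full_conditional_probability ::
    "'a set \<Rightarrow> 'a set set \<Rightarrow> ('a set \<Rightarrow> 'a set \<Rightarrow> real) \<Rightarrow> bool" where
  "full_conditional_probability \<Omega> \<F> P \<longleftrightarrow>
     (\<forall>B\<in>\<F>. B \<noteq> {} \<longrightarrow> fa_probability \<Omega> \<F> (\<lambda>E. P E B) \<and> P B B = 1) \<and>
     (\<forall>A\<in>\<F>. \<forall>B\<in>\<F>. \<forall>C\<in>\<F>. C \<inter> B \<noteq> {} \<longrightarrow>
        P (A \<inter> C) B = P A (C \<inter> B) * P C B)"

definition coherent_lower_probability ::
    "'a set \<Rightarrow> 'a set set \<Rightarrow> ('a set \<Rightarrow> real) \<Rightarrow> bool" where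
  "coherent_lower_probability \<Omega> \<D> lp \<longleftrightarrow>
     (\<exists>\<F> M. algebra \<Omega> \<F> \<and> \<D> \<subseteq> \<F> \<and> M \<noteq> {} \<and> (\<forall>p\<in>M. fa_probability \<Omega> \<F> p) \<and>
            (\<forall>E\<in>\<D>. lp E = (INF p\<in>M. p E)))"

definition conjugate_upper :: "'a set \<Rightarrow> ('a set \<Rightarrow> real) \<Rightarrow> 'a set \<Rightarrow> real" where
  "conjugate_upper \<Omega> lp E = 1 - lp (\<Omega> - E)"

definition dominating_fcps ::
    "'a set \<Rightarrow> 'a set set \<Rightarrow> 'a set set \<Rightarrow> ('a set \<Rightarrow> real) \<Rightarrow> ('a set \<Rightarrow> 'a set \<Rightarrow> real) set" where
  "dominating_fcps \<Omega> \<F> \<D> lp =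
     {P. full_conditional_probability \<Omega> \<F> P \<and> (\<forall>E\<in>\<D>. lp E \<le> P E \<Omega>)}"

text \<open>
  The algebra \<open>\<F> \<supseteq> \<D>\<close> carrying the full conditional probabilities is a parameter of the natural
  extensions; it need not be the one witnessing the coherence of \<open>lp\<close>.
\<close>

definition lower_natural_extension ::
    "'a set \<Rightarrow> 'a set set \<Rightarrow> 'a set set \<Rightarrow> ('a set \<Rightarrow> real) \<Rightarrow> 'a set \<Rightarrow> 'a set \<Rightarrow> real" where
  "lower_natural_extension \<Omega> \<F> \<D> lp A B = (INF P\<in>dominating_fcps \<Omega> \<F> \<D> lp. P A B)"

definition upper_natural_extension ::
    "'a set \<Rightarrow> 'a set set \<Rightarrow> 'a set set \<Rightarrow> ('a set \<Rightarrow> real) \<Rightarrow> 'a set \<Rightarrow> 'a set \<Rightarrow> real" where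
  "upper_natural_extension \<Omega> \<F> \<D> lp A B = (SUP P\<in>dominating_fcps \<Omega> \<F> \<D> lp. P A B)"

definition extreme_event :: "'a set \<Rightarrow> ('a set \<Rightarrow> real) \<Rightarrow> 'a set \<Rightarrow> bool" where
  "extreme_event \<Omega> lp A \<longleftrightarrow>
     (lp A = 0 \<and> conjugate_upper \<Omega> lp A = 0) \<or> (lp A = 1 \<and> conjugate_upper \<Omega> lp A = 1)"

definition logically_independent :: "'a set \<Rightarrow> 'a set \<Rightarrow> 'a set set \<Rightarrow> bool" where
  "logically_independent \<Omega> A \<B> \<longleftrightarrow> (\<forall>B\<in>\<B>. \<not> B \<subseteq> A \<and> \<not> B \<subseteq> \<Omega> - A)"

end

theory Submission
  imports Defs "HOL-Analysis.Function_Topology"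
begin

text \<open>
  Pointwise limits of probabilities along a filter exist after refining the filter (Tychonoff), and
  this drives everything. First, a coherent lower probability is attained at each event \<open>B\<close> by some
  finitely additive \<open>p\<close> on the power set that dominates it. Secondly, given such a \<open>p\<close> and a
  point \<open>c\<close>, the ratios \<open>q(E \<inter> B) / q(B)\<close> for \<open>q = p + \<epsilon> \<delta>\<^sub>c + \<epsilon>\<^sup>2 u\<^sub>S\<close>, where \<open>u\<^sub>S\<close> is
  uniform on the finite set \<open>S\<close>, have a limit as \<open>\<epsilon> \<rightarrow> 0\<close> and \<open>S\<close> grows: a full conditional
  probability that extends \<open>p\<close> and is concentrated at \<open>c\<close> given any \<open>p\<close>-null \<open>B\<close> containing
  \<open>c\<close>. If \<open>lp B = 0\<close>, taking \<open>p B = 0\<close> and \<open>c\<close> in \<open>A \<inter> B\<close> or in \<open>B - A\<close> shows that the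
  natural extensions of \<open>A\<close> given \<open>B\<close> are vacuous, 0 and 1. If \<open>lp B > 0\<close>, the product rule
  transfers \<open>P(A) \<in> {0, 1}\<close> to \<open>P(A|B)\<close>.
\<close>

section \<open>Pointwise limits of set functions along filters\<close>

text \<open>By Tychonoff the cube of functions into \<open>{0..1}\<close> is compact, so the image
  of \<open>G\<close> has a cluster point \<open>L\<close>; refining \<open>G\<close> turns the
  cluster point into a limit.\<close>

lemma pointwise_limit_subfilter:
  fixes f :: "'i \<Rightarrow> 'b \<Rightarrow> real"
  assumes "G \<noteq> bot" and bounds: "\<And>i b. b \<in> J \<Longrightarrow> f i b \<in> {0..1}"
  shows "\<exists>H L. H \<noteq> bot \<and> H \<le> G \<and> (\<forall>b\<in>J. ((\<lambda>i. f i b) \<longlongrightarrow> L b) H)"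
proof -
  \<comment> \<open>Padding with 0 outside \<open>J\<close> puts every \<open>g i\<close> into the
    full cube, since bounds on \<open>f\<close> are known on \<open>J\<close> only.\<close>
  define g where "g i b = (if b \<in> J then f i b else 0)" for i b
  let ?U = "PiE UNIV (\<lambda>_. {0..1}) :: ('b \<Rightarrow> real) set"
  have "compactin (product_topology (\<lambda>_. euclidean) UNIV) ?U"
    by (simp add: compactin_PiE)
  then have "compact ?U"
    by (simp add: euclidean_product_topology)
  moreover have "filtermap g G \<noteq> bot"
    using assms(1) by (simp add: filtermap_bot_iff)
  moreover have "eventually (\<lambda>x. x \<in> ?U) (filtermap g G)"
    unfolding eventually_filtermap using bounds by (intro always_eventually) (simp add: PiE_iff g_def)
  ultimately obtain L where L: "inf (nhds L) (filtermap g G) \<noteq> bot"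
    unfolding compact_filter by blast
  \<comment> \<open>The coarsest refinement of \<open>G\<close> along which \<open>g\<close> tends
    to \<open>L\<close>. It is proper because otherwise \<open>g\<close> would eventually avoid some
    neighbourhood of \<open>L\<close>, against \<open>L\<close> being a cluster point.\<close>
  define H where "H = inf (filtercomap g (nhds L)) G"
  have "H \<noteq> bot"
  proof
    assume "H = bot"
    then obtain P Q where PQ: "eventually P (nhds L)" "eventually Q G" "\<And>i. P (g i) \<Longrightarrow> Q i \<Longrightarrow> False"
      unfolding H_def trivial_limit_def eventually_inf eventually_filtercomap by metis
    have "eventually (\<lambda>x. \<not> P x) (filtermap g G)"
      unfolding eventually_filtermap using PQ(2) by eventually_elim (use PQ(3) in blast)
    then have "eventually (\<lambda>x. False) (inf (nhds L) (filtermap g G))"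
      using PQ(1) unfolding eventually_inf by blast
    then show False
      using L by (simp add: trivial_limit_def)
  qed
  moreover have "H \<le> G"
    by (simp add: H_def)
  moreover have "((\<lambda>i. f i b) \<longlongrightarrow> L b) H" if "b \<in> J" for b
  proof -
    have "filterlim g (nhds L) H"
      unfolding filterlim_iff_le_filtercomap H_def by simp
    then have "((\<lambda>i. g i b) \<longlongrightarrow> L b) H"
      using continuous_on_tendsto_compose[OF continuous_on_product_coordinates[of b]] by simp
    then show ?thesis
      using that by (simp add: g_def)
  qed
  ultimately show ?thesis
    by blast
qed

text \<open>Each axiom compares finitely many values and therefore passes to the limit. "Eventually"
  is the right strength for \<open>q\<close>: quotients by \<open>q i B\<close> are probabilities
  only once \<open>q i B > 0\<close>.\<close>

lemma fa_probability_limit: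
  assumes "H \<noteq> bot" "\<Omega> \<in> \<F>" and add: "\<And>E F. E \<in> \<F> \<Longrightarrow> F \<in> \<F> \<Longrightarrow> E \<union> F \<in> \<F>"
    and lim: "\<And>E. E \<in> \<F> \<Longrightarrow> ((\<lambda>i. q i E) \<longlongrightarrow> p E) H"
    and q: "eventually (\<lambda>i. fa_probability \<Omega> \<F> (q i)) H"
  shows "fa_probability \<Omega> \<F> p"
  unfolding fa_probability_def additive_def
proof (intro conjI ballI impI)
  fix E assume E: "E \<in> \<F>"
  show "0 \<le> p E"
    using \<open>H \<noteq> bot\<close> lim[OF E]
    by (rule tendsto_lowerbound[rotated 2]) (use q E in \<open>auto elim!: eventually_mono simp: fa_probability_def\<close>)
  fix F assume F: "F \<in> \<F>" and disj: "E \<inter> F = {}"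
  have "((\<lambda>i. q i E + q i F) \<longlongrightarrow> p E + p F) H"
    by (intro tendsto_add lim E F)
  moreover have "eventually (\<lambda>i. q i E + q i F = q i (E \<union> F)) H"
    using q by eventually_elim (use E F disj in \<open>auto simp: fa_probability_def additive_def\<close>)
  ultimately have "((\<lambda>i. q i (E \<union> F)) \<longlongrightarrow> p E + p F) H"
    by (rule Lim_transform_eventually)
  then show "p (E \<union> F) = p E + p F"
    using tendsto_unique[OF \<open>H \<noteq> bot\<close>] lim[OF add[OF E F]] by blast
next
  have "((\<lambda>i. q i \<Omega>) \<longlongrightarrow> 1) H"
    by (rule tendsto_eventually) (use q in \<open>auto elim!: eventually_mono simp: fa_probability_def\<close>)
  then show "p \<Omega> = 1"
    using tendsto_unique[OF \<open>H \<noteq> bot\<close>] lim[OF \<open>\<Omega> \<in> \<F>\<close>] by blast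
qed

section \<open>Elementary rules for finitely additive probabilities\<close>

lemma fa_probability_Un:
  assumes "fa_probability \<Omega> \<F> p" "E \<in> \<F>" "F \<in> \<F>" "E \<inter> F = {}"
  shows "p (E \<union> F) = p E + p F"
  using assms unfolding fa_probability_def additive_def by blast

lemma fa_probability_empty:
  assumes "fa_probability \<Omega> \<F> p" "{} \<in> \<F>"
  shows "p {} = 0"
  using fa_probability_Un[OF assms(1), of "{}" "{}"] assms(2) by simp

lemma fa_probability_compl:
  assumes "algebra \<Omega> \<F>" "fa_probability \<Omega> \<F> p" "E \<in> \<F>"
  shows "p (\<Omega> - E) = 1 - p E"
proof -
  interpret algebra \<Omega> \<F> by fact
  have "p (E \<union> (\<Omega> - E)) = p E + p (\<Omega> - E)"
    using assms(3) by (intro fa_probability_Un[OF assms(2)]) auto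
  moreover have "E \<union> (\<Omega> - E) = \<Omega>"
    using assms(3) sets_into_space by auto
  ultimately show ?thesis
    using assms(2) by (simp add: fa_probability_def)
qed

lemma fa_probability_bounds:
  assumes "algebra \<Omega> \<F>" "fa_probability \<Omega> \<F> p" "E \<in> \<F>"
  shows "p E \<in> {0..1}"
proof -
  interpret algebra \<Omega> \<F> by fact
  have "0 \<le> p (\<Omega> - E)" "0 \<le> p E"
    using assms(2,3) compl_sets by (auto simp: fa_probability_def)
  then show ?thesis
    using fa_probability_compl[OF assms] by simp
qed

lemma fa_probability_mono:
  assumes "algebra \<Omega> \<F>" "fa_probability \<Omega> \<F> p" "E \<in> \<F>" "F \<in> \<F>" "E \<subseteq> F"
  shows "p E \<le> p F"
proof -
  interpret algebra \<Omega> \<F> by fact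
  have "F - E \<in> \<F>" using assms by auto
  moreover have "p (E \<union> (F - E)) = p E + p (F - E)"
    using assms \<open>F - E \<in> \<F>\<close> by (intro fa_probability_Un[OF assms(2)]) auto
  moreover have "E \<union> (F - E) = F" using assms by auto
  ultimately show ?thesis
    using assms(2) by (simp add: fa_probability_def)
qed

section \<open>Extension of finitely additive probabilities to the power set\<close>

lemma fa_probability_extend_finite:
  assumes "algebra \<Omega> \<F>" "fa_probability \<Omega> \<F> p" "finite T" "T \<subseteq> \<F>"
  obtains q where "fa_probability \<Omega> (Pow \<Omega>) q" "\<And>E. E \<in> T \<Longrightarrow> q E = p E"
proof -
  interpret algebra \<Omega> \<F> by fact
  \<comment> \<open>Move the mass of each atom of the algebra generated by \<open>T\<close> to one of its points.\<close>
  define sig where "sig x = {E \<in> T. x \<in> E}" for x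
  define atom where "atom s = {x \<in> \<Omega>. sig x = s}" for s
  have fin: "finite (sig ` \<Omega>)"
    by (rule finite_subset[of _ "Pow T"]) (auto simp: sig_def \<open>finite T\<close>)
  \<comment> \<open>Prescribing membership in each set of \<open>U\<close> intersects finitely many
    members of \<F> or complements of members; atoms arise for \<open>U = T\<close>.\<close>
  have sep: "{x \<in> \<Omega>. \<forall>E\<in>U. x \<in> E \<longleftrightarrow> E \<in> s} \<in> \<F>" if "finite U" "U \<subseteq> \<F>" for U s
    using that
  proof (induction U)
    case (insert E U)
    have "{x \<in> \<Omega>. \<forall>D\<in>insert E U. x \<in> D \<longleftrightarrow> D \<in> s}
        = (if E \<in> s then E else \<Omega> - E) \<inter> {x \<in> \<Omega>. \<forall>D\<in>U. x \<in> D \<longleftrightarrow> D \<in> s}"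
      using insert.prems sets_into_space by auto
    then show ?case
      using insert by auto
  qed auto
  have atom: "atom s \<in> \<F>" if "s \<in> sig ` \<Omega>" for s
  proof -
    have "atom s = {x \<in> \<Omega>. \<forall>E\<in>T. x \<in> E \<longleftrightarrow> E \<in> s}"
      using that by (auto simp: atom_def sig_def)
    then show ?thesis
      using sep[OF \<open>finite T\<close> \<open>T \<subseteq> \<F>\<close>] by simp
  qed
  have sum: "(\<Sum>s\<in>S. p (atom s)) = p (\<Union>s\<in>S. atom s)" if "S \<subseteq> sig ` \<Omega>" for S
    using finite_subset[OF that fin] that
  proof (induction S)
    case empty
    then show ?case using fa_probability_empty[OF assms(2)] by simp
  next
    case (insert s S)
    have "atom s \<inter> (\<Union>s\<in>S. atom s) = {}"
      using insert.hyps by (auto simp: atom_def)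
    moreover have "(\<Union>s\<in>S. atom s) \<in> \<F>"
      using insert.hyps(1) insert.prems atom by (intro finite_UN) auto
    ultimately show ?case
      using insert fa_probability_Un[OF assms(2)] atom by simp
  qed
  define pt where "pt s = (SOME x. x \<in> \<Omega> \<and> sig x = s)" for s
  have pt: "pt s \<in> \<Omega>" "sig (pt s) = s" if "s \<in> sig ` \<Omega>" for s
    using someI_ex[of "\<lambda>x. x \<in> \<Omega> \<and> sig x = s"] that by (auto simp: pt_def)
  define q where "q E = (\<Sum>s\<in>{s \<in> sig ` \<Omega>. pt s \<in> E}. p (atom s))" for E
  \<comment> \<open>\<Omega> is included so that \<open>q \<Omega> = 1\<close> comes from the same
    argument. Every such \<open>E\<close> is a union of atoms, so an atom lies inside
    \<open>E\<close> exactly when its chosen point does.\<close>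
  have "q E = p E" if "E \<in> insert \<Omega> T" for E
  proof -
    have "pt s \<in> E \<longleftrightarrow> atom s \<subseteq> E" if s: "s \<in> sig ` \<Omega>" for s
    proof (cases "E = \<Omega>")
      case False
      then have "E \<in> T" using \<open>E \<in> insert \<Omega> T\<close> by auto
      then have "x \<in> E \<longleftrightarrow> E \<in> sig x" for x by (auto simp: sig_def)
      then show ?thesis using pt[OF s] by (auto simp: atom_def)
    qed (use pt[OF s] in \<open>auto simp: atom_def\<close>)
    moreover have "x \<in> (\<Union>s\<in>{s \<in> sig ` \<Omega>. pt s \<in> E}. atom s)" if x: "x \<in> E" for x
    proof -
      have "x \<in> \<Omega>"
        using x \<open>E \<in> insert \<Omega> T\<close> \<open>T \<subseteq> \<F>\<close> sets_into_space by auto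
      moreover have "pt (sig x) \<in> E"
      proof (cases "E = \<Omega>")
        case False
        then have "E \<in> sig x" using x \<open>E \<in> insert \<Omega> T\<close> by (auto simp: sig_def)
        then have "E \<in> sig (pt (sig x))" using pt[of "sig x"] \<open>x \<in> \<Omega>\<close> by auto
        then show ?thesis by (auto simp: sig_def)
      qed (use pt[of "sig x"] \<open>x \<in> \<Omega>\<close> in auto)
      ultimately show ?thesis by (auto simp: atom_def)
    qed
    ultimately have "(\<Union>s\<in>{s \<in> sig ` \<Omega>. pt s \<in> E}. atom s) = E"
      by blast
    then show ?thesis
      unfolding q_def by (subst sum) auto
  qed
  moreover have "fa_probability \<Omega> (Pow \<Omega>) q"
    unfolding fa_probability_def additive_def
  proof (intro conjI ballI impI)
    show "0 \<le> q E" for E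
      unfolding q_def using atom assms(2) by (intro sum_nonneg) (auto simp: fa_probability_def)
    show "q \<Omega> = 1"
      using calculation[of \<Omega>] assms(2) by (simp add: fa_probability_def)
    fix E F :: "'a set" assume "E \<inter> F = {}"
    moreover have "{s \<in> sig ` \<Omega>. pt s \<in> E \<union> F} = {s \<in> sig ` \<Omega>. pt s \<in> E} \<union> {s \<in> sig ` \<Omega>. pt s \<in> F}"
      by auto
    ultimately show "q (E \<union> F) = q E + q F"
      unfolding q_def using fin by (auto intro!: sum.union_disjoint)
  qed
  ultimately show thesis
    using that by blast
qed

text \<open>Agreement with \<open>p\<close> at one event concerns a single value, so it survives a
  limit of power-set probabilities that match \<open>p\<close> on growing finite parts of
  \<F>.\<close>

lemma fa_probability_extend:
  assumes "algebra \<Omega> \<F>" "fa_probability \<Omega> \<F> p"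
  obtains q where "fa_probability \<Omega> (Pow \<Omega>) q" "\<And>E. E \<in> \<F> \<Longrightarrow> q E = p E"
proof -
  \<comment> \<open>An infinite \<open>T\<close> imposes no constraint on \<open>q\<close>, so that
    a choice function defined for all \<open>T\<close> exists.\<close>
  have "\<exists>q. fa_probability \<Omega> (Pow \<Omega>) q \<and> (\<forall>E\<in>T \<inter> \<F>. finite T \<longrightarrow> q E = p E)" for T
  proof -
    have "finite (if finite T then T \<inter> \<F> else {})" "(if finite T then T \<inter> \<F> else {}) \<subseteq> \<F>"
      by auto
    then obtain q where "fa_probability \<Omega> (Pow \<Omega>) q"
      "\<And>E. E \<in> (if finite T then T \<inter> \<F> else {}) \<Longrightarrow> q E = p E"
      by (rule fa_probability_extend_finite[OF assms]) (rule that)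
    then show ?thesis
      by auto
  qed
  then obtain q where "\<forall>T. fa_probability \<Omega> (Pow \<Omega>) (q T) \<and>
      (\<forall>E\<in>T \<inter> \<F>. finite T \<longrightarrow> q T E = p E)"
    by (rule choice[OF allI, THEN exE])
  then have q: "\<And>T. fa_probability \<Omega> (Pow \<Omega>) (q T)"
    "\<And>T E. finite T \<Longrightarrow> E \<in> T \<inter> \<F> \<Longrightarrow> q T E = p E"
    by auto
  have bounds: "q T E \<in> {0..1}" if "E \<in> Pow \<Omega>" for T E
    using fa_probability_bounds[OF algebra_Pow q(1) that] .
  obtain H r where H: "H \<noteq> bot" "H \<le> finite_subsets_at_top \<F>"
    and r: "\<And>E. E \<in> Pow \<Omega> \<Longrightarrow> ((\<lambda>T. q T E) \<longlongrightarrow> r E) H"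
    using pointwise_limit_subfilter[OF finite_subsets_at_top_neq_bot, of "Pow \<Omega>" q \<F>, OF bounds] by blast
  show thesis
  proof (rule that)
    show "fa_probability \<Omega> (Pow \<Omega>) r"
      by (rule fa_probability_limit[OF H(1) _ _ r]) (use q in auto)
    fix E assume E: "E \<in> \<F>"
    have "eventually (\<lambda>T. q T E = p E) (finite_subsets_at_top \<F>)"
      unfolding eventually_finite_subsets_at_top
      by (rule exI[of _ "{E}"]) (use E q(2) in auto)
    then have "((\<lambda>T. q T E) \<longlongrightarrow> p E) H"
      by (intro tendsto_mono[OF H(2)] tendsto_eventually)
    moreover have "E \<in> Pow \<Omega>"
      using E assms(1) by (auto simp: algebra_iff_Un)
    ultimately show "r E = p E"
      using tendsto_unique[OF H(1) r] by simp
  qed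
qed

section \<open>Attainment of a coherent lower probability\<close>

text \<open>\<open>M\<close> itself may contain no minimiser at \<open>B\<close>. Near-minimisers
  are extended to the power set and a limit is taken: domination of \<open>lp\<close> is a closed
  condition, and the values at \<open>B\<close> tend to the infimum.\<close>

lemma coherent_lower_probability_attained:
  assumes "coherent_lower_probability \<Omega> \<D> lp" "B \<in> \<D>"
  obtains p where "fa_probability \<Omega> (Pow \<Omega>) p" "\<And>E. E \<in> \<D> \<Longrightarrow> lp E \<le> p E" "p B = lp B"
proof -
  obtain \<F> M where \<F>: "algebra \<Omega> \<F>" "\<D> \<subseteq> \<F>" and "M \<noteq> {}"
    and M: "\<And>p. p \<in> M \<Longrightarrow> fa_probability \<Omega> \<F> p"
    and lp: "\<And>E. E \<in> \<D> \<Longrightarrow> lp E = (INF p\<in>M. p E)"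
    using assms(1) unfolding coherent_lower_probability_def by blast
  have bdd: "bdd_below ((\<lambda>p. p E) ` M)" if "E \<in> \<D>" for E
    using that \<F>(2) M by (intro bdd_belowI2[of _ 0]) (auto simp: fa_probability_def)
  have lower: "lp E \<le> p E" if "E \<in> \<D>" "p \<in> M" for E p
    using that cINF_lower[OF bdd] by (simp add: lp)
  have "\<exists>p\<in>M. p B < lp B + inverse (real (Suc n))" for n
  proof -
    have "(INF p\<in>M. p B) < lp B + inverse (real (Suc n))"
      by (simp add: lp[OF \<open>B \<in> \<D>\<close>])
    then show ?thesis
      using cINF_less_iff[OF \<open>M \<noteq> {}\<close> bdd[OF \<open>B \<in> \<D>\<close>]] by blast
  qed
  then obtain m where m: "\<And>n. m n \<in> M" "\<And>n. m n B < lp B + inverse (real (Suc n))"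
    by metis
  have "\<exists>q. fa_probability \<Omega> (Pow \<Omega>) q \<and> (\<forall>E\<in>\<F>. q E = m n E)" for n
    using fa_probability_extend[OF \<F>(1) M[OF m(1)]] by metis
  then obtain q where q: "\<And>n. fa_probability \<Omega> (Pow \<Omega>) (q n)" "\<And>n E. E \<in> \<F> \<Longrightarrow> q n E = m n E"
    by metis
  have bounds: "q n E \<in> {0..1}" if "E \<in> Pow \<Omega>" for n E
    using fa_probability_bounds[OF algebra_Pow q(1) that] .
  obtain H r where H: "H \<noteq> bot" "H \<le> sequentially"
    and r: "\<And>E. E \<in> Pow \<Omega> \<Longrightarrow> ((\<lambda>n. q n E) \<longlongrightarrow> r E) H"
    using pointwise_limit_subfilter[OF sequentially_bot, of "Pow \<Omega>" q, OF bounds] by blast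
  have \<D>: "E \<in> Pow \<Omega>" if "E \<in> \<D>" for E
    using that \<F>(2) \<F>(1) by (auto simp: algebra_iff_Un)
  have lower_r: "lp E \<le> r E" if "E \<in> \<D>" for E
    using H(1) r[OF \<D>[OF that]]
    by (rule tendsto_lowerbound[rotated 2]) (use that q(2) \<F>(2) lower m(1) in \<open>auto simp: subset_iff\<close>)
  show thesis
  proof (rule that)
    show "fa_probability \<Omega> (Pow \<Omega>) r"
      by (rule fa_probability_limit[OF H(1) _ _ r]) (use q in auto)
    show "r B = lp B"
    proof (rule antisym)
      have "(\<lambda>n. lp B + inverse (real (Suc n))) \<longlonglongrightarrow> lp B + 0"
        by (intro tendsto_add tendsto_const LIMSEQ_inverse_real_of_nat)
      then have "((\<lambda>n. lp B + inverse (real (Suc n))) \<longlongrightarrow> lp B + 0) H"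
        using H(2) tendsto_mono by blast
      moreover have "eventually (\<lambda>n. q n B \<le> lp B + inverse (real (Suc n))) H"
        using m(2) q(2) \<F>(2) \<open>B \<in> \<D>\<close> by (intro always_eventually) (auto simp: subset_iff intro: less_imp_le)
      ultimately show "r B \<le> lp B"
        using tendsto_le[OF H(1) _ r[OF \<D>[OF \<open>B \<in> \<D>\<close>]]] by fastforce
    qed (use lower_r \<open>B \<in> \<D>\<close> in auto)
  qed (fact lower_r)
qed

section \<open>Full conditional probabilities with a prescribed unconditional part\<close>

text \<open>Three scales separate the conditioning events: \<open>p\<close> decides when
  \<open>p B > 0\<close>, the point mass decides on a \<open>p\<close>-null \<open>B\<close>
  containing \<open>c\<close>, and \<open>u S\<close> provides a positive denominator for all other
  nonempty \<open>B\<close>.\<close>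

lemma full_conditional_probability_extend:
  assumes p: "fa_probability \<Omega> (Pow \<Omega>) p" and "c \<in> \<Omega>"
  shows "\<exists>P. full_conditional_probability \<Omega> (Pow \<Omega>) P \<and> (\<forall>E\<subseteq>\<Omega>. P E \<Omega> = p E) \<and>
    (\<forall>A\<subseteq>\<Omega>. \<forall>B\<subseteq>\<Omega>. c \<in> A \<inter> B \<longrightarrow> p B = 0 \<longrightarrow> P A B = 1)"
proof -
  define e where "e n = inverse (real (Suc n))" for n
  \<comment> \<open>\<open>u S\<close> vanishes identically if \<open>S\<close> is empty or infinite, hence is additive for every \<open>S\<close>.\<close>
  define u where "u S E = real (card (S \<inter> E)) / real (card S)" for S E :: "'a set"
  define q where "q i E = p E + e (fst i) * (indicator E c + e (fst i) * u (snd i) E)" for i E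
  \<comment> \<open>\<open>n\<close> and \<open>S\<close> move independently: as \<open>u S\<close>
    is at most 1 for every \<open>S\<close>, the factor \<open>e n\<close> alone makes the
    perturbation vanish.\<close>
  let ?G = "sequentially \<times>\<^sub>F finite_subsets_at_top \<Omega>"
  have e: "0 < e n" for n by (simp add: e_def)
  have u: "0 \<le> u S E" "u S E \<le> 1" for S E
  proof -
    show "0 \<le> u S E" by (simp add: u_def)
    show "u S E \<le> 1"
      by (cases "finite S \<and> S \<noteq> {}") (auto simp: u_def divide_le_eq_1 card_gt_0_iff card_mono)
  qed
  have u_Un: "u S (E \<union> F) = u S E + u S F" if "E \<inter> F = {}" for S E F
  proof (cases "finite S")
    case True
    then have "card (S \<inter> (E \<union> F)) = card (S \<inter> E) + card (S \<inter> F)"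
      using that by (subst card_Un_disjoint[symmetric]) (auto simp: Int_Un_distrib)
    then show ?thesis by (simp add: u_def add_divide_distrib)
  qed (simp add: u_def)
  have q_nonneg: "0 \<le> q i E" if "E \<subseteq> \<Omega>" for i E
    using p that u(1) e[THEN less_imp_le] by (auto simp: q_def fa_probability_def)
  have q_Un: "q i (E \<union> F) = q i E + q i F" if "E \<subseteq> \<Omega>" "F \<subseteq> \<Omega>" "E \<inter> F = {}" for i E F
  proof -
    have "indicator (E \<union> F) c = (indicator E c + indicator F c :: real)"
      using that(3) by (auto simp: indicator_def)
    then show ?thesis
      using that fa_probability_Un[OF p, of E F] by (simp add: q_def u_Un algebra_simps)
  qed
  have q_mono: "q i E \<le> q i F" if "E \<subseteq> F" "F \<subseteq> \<Omega>" for i E F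
  proof -
    have "q i (E \<union> (F - E)) = q i E + q i (F - E)"
      using that by (intro q_Un) auto
    moreover have "E \<union> (F - E) = F" using that by auto
    moreover have "0 \<le> q i (F - E)" using that by (intro q_nonneg) auto
    ultimately show ?thesis by simp
  qed
  \<comment> \<open>Positivity holds for every \<open>n\<close> as soon as the finite set
    \<open>S\<close> contains a chosen point of \<open>B\<close>.\<close>
  have q_pos: "eventually (\<lambda>i. 0 < q i B) ?G" if "B \<subseteq> \<Omega>" "B \<noteq> {}" for B
  proof -
    obtain b where "b \<in> B" using \<open>B \<noteq> {}\<close> by blast
    have "0 < q (n, S) B" if "finite S" "b \<in> S" for n S
    proof -
      have "0 < card (S \<inter> B)"
        using that \<open>b \<in> B\<close> by (auto simp: card_gt_0_iff)
      moreover from this have "0 < card S"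
        using that by (auto simp: card_gt_0_iff)
      ultimately have "0 < u S B" by (simp add: u_def)
      moreover have "0 \<le> p B" using p \<open>B \<subseteq> \<Omega>\<close> by (auto simp: fa_probability_def)
      ultimately show ?thesis
        using e[of n] by (auto simp: q_def intro!: add_nonneg_pos mult_pos_pos)
    qed
    moreover have "eventually (\<lambda>S. finite S \<and> b \<in> S) (finite_subsets_at_top \<Omega>)"
      unfolding eventually_finite_subsets_at_top
      using \<open>b \<in> B\<close> \<open>B \<subseteq> \<Omega>\<close> by (intro exI[of _ "{b}"]) auto
    ultimately show ?thesis
      unfolding eventually_prod_filter
      by (intro exI[of _ "\<lambda>_. True"] exI[of _ "\<lambda>S. finite S \<and> b \<in> S"]) auto
  qed
  \<comment> \<open>Indexing by pairs lets one refinement of \<open>?G\<close> serve all conditional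
    values at once. The bounds on \<open>f\<close> also hold where \<open>q i B = 0\<close>, since
    division by zero yields 0.\<close>
  define J where "J = {(E, B). E \<subseteq> \<Omega> \<and> B \<subseteq> \<Omega>}"
  define f where "f i = (\<lambda>(E, B). q i (E \<inter> B) / q i B)" for i
  have G: "?G \<noteq> bot" by (simp add: prod_filter_eq_bot)
  have bounds: "f i b \<in> {0..1}" if J: "b \<in> J" for i b
  proof -
    obtain E B where b: "b = (E, B)" "E \<subseteq> \<Omega>" "B \<subseteq> \<Omega>"
      using J by (auto simp: J_def)
    then have "0 \<le> q i (E \<inter> B)" "q i (E \<inter> B) \<le> q i B"
      by (auto intro!: q_nonneg q_mono)
    then show ?thesis
      by (auto simp: b f_def divide_le_eq_1)
  qed
  obtain H L where H: "H \<noteq> bot" "H \<le> ?G"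
    and L: "\<And>b. b \<in> J \<Longrightarrow> ((\<lambda>i. f i b) \<longlongrightarrow> L b) H"
    using pointwise_limit_subfilter[OF G, of J f, OF bounds] by blast
  define P where "P E B = L (E, B)" for E B
  have P: "((\<lambda>i. q i (E \<inter> B) / q i B) \<longlongrightarrow> P E B) H" if "E \<subseteq> \<Omega>" "B \<subseteq> \<Omega>" for E B
    using L[of "(E, B)"] that by (simp add: J_def f_def P_def)
  have q_pos_H: "eventually (\<lambda>i. 0 < q i B) H" if "B \<subseteq> \<Omega>" "B \<noteq> {}" for B
    using q_pos[OF that] H(2) filter_leD by blast
  have PI: "P E B = l" if "E \<subseteq> \<Omega>" "B \<subseteq> \<Omega>" "((\<lambda>i. q i (E \<inter> B) / q i B) \<longlongrightarrow> l) H" for E B l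
    using tendsto_unique[OF H(1) P[OF that(1,2)] that(3)] .
  have "e \<longlonglongrightarrow> 0"
    unfolding e_def by (rule LIMSEQ_inverse_real_of_nat)
  then have "((\<lambda>i. e (fst i)) \<longlongrightarrow> 0) ?G"
    by (rule filterlim_compose) (rule filterlim_fst)
  then have e_lim: "((\<lambda>i. e (fst i)) \<longlongrightarrow> 0) H"
    using H(2) tendsto_mono by blast
  have q_lim: "((\<lambda>i. q i E) \<longlongrightarrow> p E) H" for E
  proof -
    have "((\<lambda>i. e (fst i) * u (snd i) E) \<longlongrightarrow> 0) H"
      by (rule tendsto_sandwich[OF _ _ tendsto_const e_lim])
        (use u e[THEN less_imp_le] in \<open>auto intro!: always_eventually mult_left_le\<close>)
    then have "((\<lambda>i. q i E) \<longlongrightarrow> p E + 0 * (indicator E c + 0)) H"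
      unfolding q_def by (intro tendsto_intros e_lim)
    then show ?thesis by simp
  qed
  show ?thesis
  proof (intro exI[of _ P] conjI allI impI)
    show "full_conditional_probability \<Omega> (Pow \<Omega>) P"
      unfolding full_conditional_probability_def
    proof (intro conjI ballI impI)
      fix B assume B: "B \<in> Pow \<Omega>" "B \<noteq> {}"
      have one: "((\<lambda>i. q i B / q i B) \<longlongrightarrow> 1) H"
        using q_pos_H[of B] B by (intro tendsto_eventually) (auto elim!: eventually_mono)
      show "P B B = 1"
        using B one by (intro PI) auto
      show "fa_probability \<Omega> (Pow \<Omega>) (\<lambda>E. P E B)"
      proof (rule fa_probability_limit[OF H(1), where q = "\<lambda>i E. q i (E \<inter> B) / q i B"])
        show "((\<lambda>i. q i (E \<inter> B) / q i B) \<longlongrightarrow> P E B) H" if "E \<in> Pow \<Omega>" for E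
          using that B by (intro P) auto
        have fa: "fa_probability \<Omega> (Pow \<Omega>) (\<lambda>E. q i (E \<inter> B) / q i B)" if "0 < q i B" for i
          unfolding fa_probability_def additive_def
        proof (intro conjI ballI impI)
          show "0 \<le> q i (E \<inter> B) / q i B" for E :: "'a set"
            using B that by (intro divide_nonneg_pos q_nonneg) auto
          have "\<Omega> \<inter> B = B" using B by auto
          then show "q i (\<Omega> \<inter> B) / q i B = 1" using that by simp
          fix E F :: "'a set" assume "E \<inter> F = {}"
          then have "q i (E \<inter> B \<union> F \<inter> B) = q i (E \<inter> B) + q i (F \<inter> B)"
            using B by (intro q_Un) auto
          then show "q i ((E \<union> F) \<inter> B) / q i B = q i (E \<inter> B) / q i B + q i (F \<inter> B) / q i B"
            by (simp add: Int_Un_distrib2 add_divide_distrib)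
        qed
        show "eventually (\<lambda>i. fa_probability \<Omega> (Pow \<Omega>) (\<lambda>E. q i (E \<inter> B) / q i B)) H"
        proof -
          have "eventually (\<lambda>i. 0 < q i B) H"
            using B by (intro q_pos_H) auto
          then show ?thesis
            by (rule eventually_mono) (rule fa)
        qed
      qed auto
    next
      fix A B C assume ABC: "A \<in> Pow \<Omega>" "B \<in> Pow \<Omega>" "C \<in> Pow \<Omega>" "C \<inter> B \<noteq> {}"
      \<comment> \<open>The product rule holds for the ratios by cancelling
        \<open>q i (C \<inter> B)\<close>, which is eventually positive, and then passes to the
        limit.\<close>
      have "((\<lambda>i. q i (A \<inter> (C \<inter> B)) / q i (C \<inter> B) * (q i (C \<inter> B) / q i B))
          \<longlongrightarrow> P A (C \<inter> B) * P C B) H"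
        using ABC by (intro tendsto_mult P) auto
      moreover have "eventually (\<lambda>i. 0 < q i (C \<inter> B)) H"
        using ABC by (intro q_pos_H) auto
      then have "eventually (\<lambda>i. q i (A \<inter> (C \<inter> B)) / q i (C \<inter> B) * (q i (C \<inter> B) / q i B)
          = q i (A \<inter> C \<inter> B) / q i B) H"
        by eventually_elim (simp add: Int_assoc)
      ultimately have "((\<lambda>i. q i (A \<inter> C \<inter> B) / q i B) \<longlongrightarrow> P A (C \<inter> B) * P C B) H"
        by (rule Lim_transform_eventually)
      then show "P (A \<inter> C) B = P A (C \<inter> B) * P C B"
        using ABC by (intro PI) auto
    qed
    fix E assume E: "E \<subseteq> \<Omega>"
    have "p \<Omega> = 1" using p by (simp add: fa_probability_def)
    then have "((\<lambda>i. q i E / q i \<Omega>) \<longlongrightarrow> p E) H"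
      using tendsto_divide[OF q_lim[of E] q_lim[of \<Omega>]] by simp
    moreover have "E \<inter> \<Omega> = E" using E by auto
    ultimately show "P E \<Omega> = p E"
      using E by (intro PI) auto
  next
    fix A B assume AB: "A \<subseteq> \<Omega>" "B \<subseteq> \<Omega>" "c \<in> A \<inter> B" "p B = 0"
    \<comment> \<open>With \<open>e\<close> short for \<open>e (fst i)\<close>: the point mass at
      \<open>c\<close> gives the numerator at least \<open>e\<close>, and \<open>p B = 0\<close>
      leaves the denominator at most \<open>e + e * e\<close>.\<close>
    have bounds: "1 / (1 + e (fst i)) \<le> q i (A \<inter> B) / q i B" "q i (A \<inter> B) / q i B \<le> 1" for i
    proof -
      let ?e = "e (fst i)"
      have "0 \<le> p (A \<inter> B)" using p AB by (auto simp: fa_probability_def)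
      then have "?e \<le> q i (A \<inter> B)"
        using AB u(1)[of "snd i" "A \<inter> B"] e[of "fst i"] by (simp add: q_def algebra_simps)
      moreover have "q i B \<le> ?e * (1 + ?e)"
        using AB u(2)[of "snd i" B] e[of "fst i"] by (simp add: q_def)
      moreover have "q i (A \<inter> B) \<le> q i B"
        using AB by (intro q_mono) auto
      ultimately have "?e / (?e * (1 + ?e)) \<le> q i (A \<inter> B) / q i B"
        using e[of "fst i"] by (intro frac_le) linarith+
      then show "1 / (1 + ?e) \<le> q i (A \<inter> B) / q i B"
        using e[of "fst i"] by simp
      show "q i (A \<inter> B) / q i B \<le> 1"
        using \<open>q i (A \<inter> B) \<le> q i B\<close> \<open>?e \<le> q i (A \<inter> B)\<close> e[of "fst i"]
        by (simp add: divide_le_eq_1)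
    qed
    have "((\<lambda>i. 1 / (1 + e (fst i))) \<longlongrightarrow> 1 / (1 + 0)) H"
      by (intro tendsto_intros e_lim) simp
    then have lim: "((\<lambda>i. 1 / (1 + e (fst i))) \<longlongrightarrow> 1) H"
      by simp
    have "((\<lambda>i. q i (A \<inter> B) / q i B) \<longlongrightarrow> 1) H"
      by (rule tendsto_sandwich[OF _ _ lim tendsto_const]) (intro always_eventually allI bounds)+
    then show "P A B = 1"
      using AB by (intro PI) auto
  qed
qed

lemma full_conditional_probability_subalgebra:
  assumes "full_conditional_probability \<Omega> \<G> P" "\<F> \<subseteq> \<G>"
  shows "full_conditional_probability \<Omega> \<F> P"
  using assms by (simp add: full_conditional_probability_def fa_probability_def additive_def subset_iff)

section \<open>Natural extensions of an extreme event\<close>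

text \<open>\<F> is an arbitrary algebra containing \<D>, which covers the power set. The
  \<open>\<noteq>\<close> between the two strict inequalities is an exclusive or: exactly one of
  them holds.\<close>

theorem proposition7p5:
  fixes \<Omega> A :: "'a set" and \<B> \<D> \<F> :: "'a set set" and lp :: "'a set \<Rightarrow> real"
  assumes "partition_on \<Omega> \<B>"
    and "A \<in> \<D>" and "\<Omega> - A \<in> \<D>" and "\<B> \<subseteq> \<D>"
    and "coherent_lower_probability \<Omega> \<D> lp"
    and "algebra \<Omega> \<F>" and "\<D> \<subseteq> \<F>"
    and "extreme_event \<Omega> lp A"
    and "logically_independent \<Omega> A \<B>"
  shows "\<forall>B\<in>\<B>.
    (0 < lp B \<longrightarrow>
       lower_natural_extension \<Omega> \<F> \<D> lp A B = lp A \<and>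
       lp A = conjugate_upper \<Omega> lp A \<and>
       conjugate_upper \<Omega> lp A = upper_natural_extension \<Omega> \<F> \<D> lp A B) \<and>
    (lp B = 0 \<longrightarrow>
       lower_natural_extension \<Omega> \<F> \<D> lp A B \<le> lp A \<and>
       lp A \<le> conjugate_upper \<Omega> lp A \<and>
       conjugate_upper \<Omega> lp A \<le> upper_natural_extension \<Omega> \<F> \<D> lp A B \<and>
       (lower_natural_extension \<Omega> \<F> \<D> lp A B < lp A) \<noteq>
       (conjugate_upper \<Omega> lp A < upper_natural_extension \<Omega> \<F> \<D> lp A B))"
proof
  interpret algebra \<Omega> \<F> by fact
  fix B assume "B \<in> \<B>"
  have in_\<F>: "A \<in> \<F>" "B \<in> \<F>" and "B \<in> \<D>"
    using assms(2,4,7) \<open>B \<in> \<B>\<close> by auto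
  then have sub: "A \<subseteq> \<Omega>" "B \<subseteq> \<Omega>"
    using sets_into_space by auto
  obtain a b where ab: "a \<in> A \<inter> B" "b \<in> B - A"
  proof -
    have "\<not> B \<subseteq> A" "\<not> B \<subseteq> \<Omega> - A"
      using assms(9) \<open>B \<in> \<B>\<close> by (auto simp: logically_independent_def)
    then show thesis
      using that sub(2) by blast
  qed
  let ?X = "dominating_fcps \<Omega> \<F> \<D> lp"
  have X: "full_conditional_probability \<Omega> \<F> P" "\<And>E. E \<in> \<D> \<Longrightarrow> lp E \<le> P E \<Omega>" if "P \<in> ?X" for P
    using that by (auto simp: dominating_fcps_def)
  have X_fa: "fa_probability \<Omega> \<F> (\<lambda>E. P E C)" if "P \<in> ?X" "C \<in> \<F>" "C \<noteq> {}" for P C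
    using X(1)[OF that(1)] that(2,3) by (auto simp: full_conditional_probability_def)
  have X_mult: "P (E \<inter> C) D = P E (C \<inter> D) * P C D"
    if "P \<in> ?X" "E \<in> \<F>" "C \<in> \<F>" "D \<in> \<F>" "C \<inter> D \<noteq> {}" for P C D E
    using X(1)[OF that(1)] that(2-5) unfolding full_conditional_probability_def by metis
  have X_bounds: "P A B \<in> {0..1}" if "P \<in> ?X" for P
    using fa_probability_bounds[OF assms(6) X_fa[OF that]] in_\<F> ab by auto
  obtain p where p: "fa_probability \<Omega> (Pow \<Omega>) p" "\<And>E. E \<in> \<D> \<Longrightarrow> lp E \<le> p E" "p B = lp B"
    using coherent_lower_probability_attained[OF assms(5) \<open>B \<in> \<D>\<close>] by blast
  \<comment> \<open>\<open>lp B = 0\<close> is a premise inside the quantifier so that the same fact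
    also shows \<open>?X\<close> nonempty when \<open>lp B > 0\<close>.\<close>
  have witness: "\<exists>P\<in>?X. \<forall>C\<subseteq>\<Omega>. c \<in> C \<longrightarrow> lp B = 0 \<longrightarrow> P C B = 1" if c: "c \<in> B" for c
  proof -
    have "c \<in> \<Omega>" using c sub by auto
    obtain P where P: "full_conditional_probability \<Omega> (Pow \<Omega>) P" "\<And>E. E \<subseteq> \<Omega> \<Longrightarrow> P E \<Omega> = p E"
      "\<And>A B. A \<subseteq> \<Omega> \<Longrightarrow> B \<subseteq> \<Omega> \<Longrightarrow> c \<in> A \<inter> B \<Longrightarrow> p B = 0 \<Longrightarrow> P A B = 1"
      using full_conditional_probability_extend[OF p(1) \<open>c \<in> \<Omega>\<close>] by (elim exE conjE) (simp add: that)
    have "P \<in> ?X"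
      \<comment> \<open>\<open>P\<close> lives on the power set and is restricted to \<F>.\<close>
      using full_conditional_probability_subalgebra[OF P(1) space_closed] P(2) p(2) assms(7) sets_into_space
      by (auto simp: dominating_fcps_def)
    moreover have "P C B = 1" if "C \<subseteq> \<Omega>" "c \<in> C" "lp B = 0" for C
      using that p(3) c sub by (intro P(3)) auto
    ultimately show ?thesis
      by blast
  qed
  have "?X \<noteq> {}"
    using witness ab by auto
  have lp_A: "lp A \<in> {0, 1}" and conj: "conjugate_upper \<Omega> lp A = lp A"
    using assms(8) by (auto simp: extreme_event_def)
  show "(0 < lp B \<longrightarrow>
       lower_natural_extension \<Omega> \<F> \<D> lp A B = lp A \<and>
       lp A = conjugate_upper \<Omega> lp A \<and>
       conjugate_upper \<Omega> lp A = upper_natural_extension \<Omega> \<F> \<D> lp A B) \<and>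
    (lp B = 0 \<longrightarrow>
       lower_natural_extension \<Omega> \<F> \<D> lp A B \<le> lp A \<and>
       lp A \<le> conjugate_upper \<Omega> lp A \<and>
       conjugate_upper \<Omega> lp A \<le> upper_natural_extension \<Omega> \<F> \<D> lp A B \<and>
       (lower_natural_extension \<Omega> \<F> \<D> lp A B < lp A) \<noteq>
       (conjugate_upper \<Omega> lp A < upper_natural_extension \<Omega> \<F> \<D> lp A B))"
  proof (intro conjI[OF impI impI])
    assume "0 < lp B"
    have "P A B = lp A" if "P \<in> ?X" for P
    proof -
      \<comment> \<open>\<open>P E B * P B \<Omega>\<close> equals
        \<open>P (E \<inter> B) \<Omega>\<close>, which is at most 0, while
        \<open>P B \<Omega>\<close> is at least \<open>lp B > 0\<close>.\<close>
      have null: "P E B = 0" if "E \<in> \<F>" "P E \<Omega> \<le> 0" for E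
      proof -
        have "\<Omega> \<in> \<F>" "\<Omega> \<noteq> {}" "B \<inter> \<Omega> = B" "B \<inter> \<Omega> \<noteq> {}"
          using sub ab by auto
        then have "P (E \<inter> B) \<Omega> = P E B * P B \<Omega>"
          using X_mult[OF \<open>P \<in> ?X\<close> \<open>E \<in> \<F>\<close> in_\<F>(2) \<open>\<Omega> \<in> \<F>\<close>] by simp
        moreover have "P (E \<inter> B) \<Omega> \<le> P E \<Omega>"
          using in_\<F> that
          by (intro fa_probability_mono[OF assms(6) X_fa[OF \<open>P \<in> ?X\<close> \<open>\<Omega> \<in> \<F>\<close> \<open>\<Omega> \<noteq> {}\<close>]]) auto
        moreover have "0 < P B \<Omega>"
          using X(2)[OF \<open>P \<in> ?X\<close> \<open>B \<in> \<D>\<close>] \<open>0 < lp B\<close> by simp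
        moreover have "0 \<le> P E B"
          using X_fa[OF \<open>P \<in> ?X\<close>, of B] in_\<F> ab that by (auto simp: fa_probability_def)
        ultimately show ?thesis
          using that by (smt (verit) mult_pos_pos)
      qed
      have compl: "P (\<Omega> - A) C = 1 - P A C" if "C \<in> \<F>" "C \<noteq> {}" for C
        using fa_probability_compl[OF assms(6) X_fa[OF \<open>P \<in> ?X\<close> that]] in_\<F> by simp
      have "\<Omega> \<noteq> {}" "B \<noteq> {}" using ab sub by auto
      note compl = compl[OF top \<open>\<Omega> \<noteq> {}\<close>] compl[OF in_\<F>(2) \<open>B \<noteq> {}\<close>]
      \<comment> \<open>Domination at \<open>A\<close> and at its complement encloses
        \<open>P A \<Omega>\<close> between \<open>lp A\<close> and its conjugate, which
        coincide.\<close>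
      have "P A \<Omega> = lp A"
        using X(2)[OF that assms(2)] X(2)[OF that assms(3)] compl(1) conj
        by (simp add: conjugate_upper_def)
      moreover have "\<Omega> - A \<in> \<F>"
        using in_\<F> by auto
      \<comment> \<open>\<open>null\<close> is applied to \<open>A\<close> if
        \<open>lp A = 0\<close> and to its complement if \<open>lp A = 1\<close>.\<close>
      ultimately show ?thesis
        using lp_A null[OF in_\<F>(1)] null[of "\<Omega> - A"] compl by auto
    qed
    then have "(\<lambda>P. P A B) ` ?X = {lp A}"
      using \<open>?X \<noteq> {}\<close> by force
    then show "lower_natural_extension \<Omega> \<F> \<D> lp A B = lp A \<and>
       lp A = conjugate_upper \<Omega> lp A \<and>
       conjugate_upper \<Omega> lp A = upper_natural_extension \<Omega> \<F> \<D> lp A B"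
      using conj by (simp add: lower_natural_extension_def upper_natural_extension_def)
  next
    assume "lp B = 0"
    have "a \<in> B" "a \<in> A" "b \<in> B" "b \<in> \<Omega> - A"
      using ab sub by auto
    \<comment> \<open>Concentration at \<open>a\<close> gives \<open>P\<close>, concentration at
      \<open>b\<close> gives \<open>Q\<close>; they attain the extreme values 1 and 0 of the
      probability of \<open>A\<close> given \<open>B\<close>.\<close>
    then obtain P Q where P: "P \<in> ?X" "P A B = 1" and Q: "Q \<in> ?X" "Q (\<Omega> - A) B = 1"
      using witness[of a] witness[of b] sub(1) \<open>lp B = 0\<close> by (meson Diff_subset)
    have "Q A B = 0"
      using fa_probability_compl[OF assms(6) X_fa[OF Q(1)] in_\<F>(1), of B] Q(2) in_\<F>(2) ab by auto
    have "lower_natural_extension \<Omega> \<F> \<D> lp A B = 0"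
      unfolding lower_natural_extension_def
    proof (rule cInf_eq_minimum)
      show "0 \<in> (\<lambda>P. P A B) ` ?X"
        using \<open>Q A B = 0\<close> by (intro image_eqI[where x = Q]) (simp_all add: Q(1))
    qed (use X_bounds in auto)
    moreover have "upper_natural_extension \<Omega> \<F> \<D> lp A B = 1"
      unfolding upper_natural_extension_def
    proof (rule cSup_eq_maximum)
      show "1 \<in> (\<lambda>P. P A B) ` ?X"
        using P(2) by (intro image_eqI[where x = P]) (simp_all add: P(1))
    qed (use X_bounds in auto)
    \<comment> \<open>With extensions 0 and 1, the upper inequality is the strict one if
      \<open>lp A = 0\<close>, the lower one if \<open>lp A = 1\<close>.\<close>
    ultimately show "lower_natural_extension \<Omega> \<F> \<D> lp A B \<le> lp A \<and>
       lp A \<le> conjugate_upper \<Omega> lp A \<and>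
       conjugate_upper \<Omega> lp A \<le> upper_natural_extension \<Omega> \<F> \<D> lp A B \<and>
       (lower_natural_extension \<Omega> \<F> \<D> lp A B < lp A) \<noteq>
       (conjugate_upper \<Omega> lp A < upper_natural_extension \<Omega> \<F> \<D> lp A B)"
      using lp_A conj by auto
  qed
qed

end
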